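(* There exists $C>0$ such that, for all $\epsilon>0$, $$R_\epsilon(\beta,x)=\epsilon^{-\frac{4\beta}{1+2\beta}}\inf_\mu E_x\|\tilde x_{\epsilon\mu}-x\|^2<C<\infty,$$ where $\tilde x_{\epsilon\mu}$ is the Pinsker estimator with parameter $\mu$ and weights $b_j=j^\beta$, if and only if $x$ belongs to the Sobolev space $$S^\beta=\Big\{x:\ \sum_{j=1}^\infty b_j^2x_j^2<\infty,\quad x=\{x_j\}_{j=1}^\infty\Big\}.$$
   Context: One observes $y_j=x_j+\epsilon\sigma_j\xi_j$, $1\le j<\infty$, $\epsilon>0$, where $\sigma_j>0$ are known constants and $\xi_j$ are independent Gaussian random variables with $E\xi_j=0$, $E\xi_j^2=1$; the problem is to estimate $x=\{x_j\}_{j=1}^\infty$. $E_x$ is expectation when the true parameter is $x$, and $\|x\|^2=\sum_{j=1}^\infty x_j^2$. The Pinsker estimator $\tilde x_{\epsilon\mu}=\{\tilde x_{\epsilon j}\}_{j=1}^\infty$ is the linear estimator $\tilde x_{\epsilon j}=\lambda_{\epsilon j}y_j$ with $\lambda_{\epsilon j}=(1-\mu b_j)_+$, where $b_j=j^\beta$, $\beta>0$, and $(t)_+=\max(t,0)$. In Pinsker's original setting, minimax estimation on the ellipsoid $\{x:\sum_{j=1}^\infty b_j^2x_j^2\le P\}$ with $P>0$, the parameter $\mu$ is defined by the equation $\epsilon^2\sum_{j=1}^\infty b_j^2((\mu b_j)^{-1}-1)_+=P$; in $R_\epsilon(\beta,x)$ the infimum is taken over $\mu$.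
   Formalization: The noise levels σ_j are assumed to satisfy 0 < s ≤ σ_j ≤ S for all j; for arbitrary σ_j > 0 the claim is false (σ_j = 2^{-j} and any square-summable x outside S^β give bounded R_ε). *)

theory Defs
  imports "HOL-Probability.Probability"
begin

text \<open>
  Sequences \<open>x\<^sub>1, x\<^sub>2, \<dots>\<close> are functions on \<^typ>\<open>nat\<close> whose value at \<open>0\<close> is ignored: every sum
  runs over the indices \<open>Suc j\<close>. Norms and risks take values in \<^typ>\<open>ennreal\<close>, so that the risk is
  \<open>\<infinity>\<close>, rather than an arbitrary default, when the squared error is not integrable or when
  the sequence is not square summable.
\<close>

definition observation ::
    "real \<Rightarrow> (nat \<Rightarrow> real) \<Rightarrow> (nat \<Rightarrow> real) \<Rightarrow> (nat \<Rightarrow> real) \<Rightarrow> nat \<Rightarrow> real" where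
  "observation \<epsilon> \<sigma> x z j = x j + \<epsilon> * \<sigma> j * z j"

definition pinsker_weight :: "real \<Rightarrow> nat \<Rightarrow> real" where
  "pinsker_weight \<beta> j = real j powr \<beta>"

definition pinsker_coeff :: "real \<Rightarrow> real \<Rightarrow> nat \<Rightarrow> real" where
  "pinsker_coeff \<beta> \<mu> j = max (1 - \<mu> * pinsker_weight \<beta> j) 0"

definition pinsker_estimator :: "real \<Rightarrow> real \<Rightarrow> (nat \<Rightarrow> real) \<Rightarrow> nat \<Rightarrow> real" where
  "pinsker_estimator \<beta> \<mu> y j = pinsker_coeff \<beta> \<mu> j * y j"

definition sq_norm :: "(nat \<Rightarrow> real) \<Rightarrow> ennreal" where
  "sq_norm x = (\<Sum>j. ennreal ((x (Suc j))\<^sup>2))"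

definition pinsker_risk ::
    "'a measure \<Rightarrow> (nat \<Rightarrow> 'a \<Rightarrow> real) \<Rightarrow> (nat \<Rightarrow> real) \<Rightarrow> real \<Rightarrow> real \<Rightarrow> real \<Rightarrow> (nat \<Rightarrow> real) \<Rightarrow> ennreal" where
  "pinsker_risk M \<xi> \<sigma> \<beta> \<epsilon> \<mu> x =
     (\<integral>\<^sup>+ \<omega>. sq_norm (\<lambda>j. pinsker_estimator \<beta> \<mu> (observation \<epsilon> \<sigma> x (\<lambda>i. \<xi> i \<omega>)) j - x j) \<partial>M)"

text \<open>
  The parameter ranges over \<open>\<mu> > 0\<close>, as forced by Pinsker's equation
  \<open>\<epsilon>\<^sup>2 (\<Sum>j. b\<^sub>j\<^sup>2 max ((\<mu> b\<^sub>j)\<inverse> - 1) 0) = P\<close> with \<open>P > 0\<close>.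
  If the \<open>\<sigma>\<^sub>j\<close> are bounded away from \<open>0\<close>, the risk is \<open>\<infinity>\<close> for every \<open>\<mu> \<le> 0\<close>, so
  the infimum over all real \<open>\<mu>\<close> is then the same.
\<close>

definition normalized_pinsker_risk ::
    "'a measure \<Rightarrow> (nat \<Rightarrow> 'a \<Rightarrow> real) \<Rightarrow> (nat \<Rightarrow> real) \<Rightarrow> real \<Rightarrow> real \<Rightarrow> (nat \<Rightarrow> real) \<Rightarrow> ennreal" where
  "normalized_pinsker_risk M \<xi> \<sigma> \<beta> \<epsilon> x =
     ennreal (\<epsilon> powr (- (4 * \<beta> / (1 + 2 * \<beta>)))) * (INF \<mu>\<in>{0<..}. pinsker_risk M \<xi> \<sigma> \<beta> \<epsilon> \<mu> x)"

definition sobolev_space :: "real \<Rightarrow> (nat \<Rightarrow> real) set" where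
  "sobolev_space \<beta> = {x. summable (\<lambda>j. (pinsker_weight \<beta> (Suc j))\<^sup>2 * (x (Suc j))\<^sup>2)}"

end

theory Submission
  imports Defs
begin

text \<open>
  The squared error splits into a bias and a variance,
  \<open>E\<^sub>x\<parallel>\<lambda>y - x\<parallel>\<^sup>2 = \<Sum>\<^sub>j (1 - \<lambda>\<^sub>j)\<^sup>2 x\<^sub>j\<^sup>2 + \<epsilon>\<^sup>2 \<Sum>\<^sub>j \<sigma>\<^sub>j\<^sup>2 \<lambda>\<^sub>j\<^sup>2\<close>
  (\<open>pinsker_risk_eq\<close>), with \<open>1 - \<lambda>\<^sub>j = min (\<mu> b\<^sub>j) 1\<close>. It is convenient to write the noise level as
  \<open>\<epsilon>\<^sup>2 = h\<^bsup>-(1+2\<beta>)\<^esup>\<close> for a bandwidth \<open>h > 0\<close>: the normalizing factor \<open>\<epsilon>\<^bsup>-4\<beta>/(1+2\<beta>)\<^esup>\<close> is then \<open>h\<^bsup>2\<beta>\<^esup>\<close>,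
  and the normalized risk becomes
  \<open>h\<^bsup>2\<beta>\<^esup> \<Sum>\<^sub>j min (\<mu> b\<^sub>j) 1\<^sup>2 x\<^sub>j\<^sup>2 + h\<inverse> \<Sum>\<^sub>j \<sigma>\<^sub>j\<^sup>2 \<lambda>\<^sub>j\<^sup>2\<close>.

  If \<open>x\<close> is in the Sobolev space, the choice \<open>\<mu> = h\<^bsup>-\<beta>\<^esup>\<close> balances the two parts. The bias part is at
  most \<open>\<Sum>\<^sub>j b\<^sub>j\<^sup>2 x\<^sub>j\<^sup>2\<close>, and \<open>\<lambda>\<^sub>j\<close> vanishes for \<open>j \<ge> h\<close>, so that the variance part is at most \<open>S\<^sup>2\<close>
  (\<open>normalized_risk_le\<close>).

  Conversely, let the normalized risk be below \<open>C\<close> for every \<open>\<epsilon>\<close>, and take \<open>h = N\<close> a positive integer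
  and \<open>\<mu>\<close> nearly optimal. The variance prevents \<open>\<mu>\<close> from being small: if \<open>\<mu> (k N)\<^sup>\<beta> \<le> 1/2\<close>, then
  \<open>\<lambda>\<^sub>j \<ge> 1/2\<close> for the first \<open>k N\<close> indices, and the variance part is at least \<open>s\<^sup>2 k / 4\<close>, which for a fixed
  large \<open>k\<close> exceeds \<open>C\<close>. Since \<open>\<mu>\<close> is then at least a constant multiple of \<open>N\<^bsup>-\<beta>\<^esup>\<close>, the bias part
  dominates a constant multiple of \<open>\<Sum>\<^bsub>j\<le>N\<^esub> b\<^sub>j\<^sup>2 x\<^sub>j\<^sup>2\<close>, with a constant independent of \<open>N\<close>
  (\<open>weighted_energy_le\<close>). Letting \<open>N\<close> grow gives membership in the Sobolev space.
\<close>

section \<open>Bias and variance\<close>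

lemma (in prob_space) nn_integral_affine_std_normal_square:
  fixes X :: "'a \<Rightarrow> real"
  assumes "distributed M lborel X std_normal_density"
  shows "(\<integral>\<^sup>+ \<omega>. ennreal ((a + b * X \<omega>)\<^sup>2) \<partial>M) = ennreal (a\<^sup>2 + b\<^sup>2)"
proof -
  have [measurable]: "X \<in> borel_measurable M"
    using distributed_measurable[OF assms] by simp
  have mom: "integrable M (\<lambda>\<omega>. X \<omega> ^ k)" for k
    using integrable_std_normal_moment[of k] distributed_integrable[OF assms, of "\<lambda>t. t ^ k"]
    by (simp add: mult.commute)
  have mean: "expectation X = 0"
    using standard_normal_distributed_expectation[OF assms] .
  have second: "expectation (\<lambda>\<omega>. (X \<omega>)\<^sup>2) = 1"
    using standard_normal_distributed_variance[OF assms] mean by simp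
  have int1: "integrable M X" and int2: "integrable M (\<lambda>\<omega>. (X \<omega>)\<^sup>2)"
    using mom[of 1] mom[of 2] by simp_all
  have expand: "(a + b * X \<omega>)\<^sup>2 = a\<^sup>2 + 2 * a * b * X \<omega> + b\<^sup>2 * (X \<omega>)\<^sup>2" for \<omega>
    by (simp add: power2_eq_square algebra_simps)
  have "integrable M (\<lambda>\<omega>. (a + b * X \<omega>)\<^sup>2)"
    unfolding expand using int1 int2 by simp
  then have "(\<integral>\<^sup>+ \<omega>. ennreal ((a + b * X \<omega>)\<^sup>2) \<partial>M) = ennreal (expectation (\<lambda>\<omega>. (a + b * X \<omega>)\<^sup>2))"
    by (intro nn_integral_eq_integral) auto
  also have "expectation (\<lambda>\<omega>. (a + b * X \<omega>)\<^sup>2) = a\<^sup>2 + b\<^sup>2"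
    unfolding expand using int1 int2 by (simp add: mean second prob_space)
  finally show ?thesis .
qed

lemma pinsker_risk_eq:
  assumes "prob_space M"
    and normal: "\<And>j. j \<ge> 1 \<Longrightarrow> distributed M lborel (\<xi> j) std_normal_density"
  shows "pinsker_risk M \<xi> \<sigma> \<beta> \<epsilon> \<mu> x =
    (\<Sum>j. ennreal (((1 - pinsker_coeff \<beta> \<mu> (Suc j)) * x (Suc j))\<^sup>2
                + (pinsker_coeff \<beta> \<mu> (Suc j) * \<epsilon> * \<sigma> (Suc j))\<^sup>2))"
proof -
  interpret prob_space M by fact
  have [measurable]: "\<xi> (Suc j) \<in> borel_measurable M" for j
    using distributed_measurable[OF normal[of "Suc j"]] by simp
  have error: "pinsker_estimator \<beta> \<mu> (observation \<epsilon> \<sigma> x (\<lambda>i. \<xi> i \<omega>)) j - x j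
      = - ((1 - pinsker_coeff \<beta> \<mu> j) * x j) + (pinsker_coeff \<beta> \<mu> j * \<epsilon> * \<sigma> j) * \<xi> j \<omega>" for j \<omega>
    by (simp add: pinsker_estimator_def observation_def algebra_simps)
  have "(\<integral>\<^sup>+ \<omega>. ennreal ((- c + d * \<xi> (Suc j) \<omega>)\<^sup>2) \<partial>M) = ennreal (c\<^sup>2 + d\<^sup>2)" for c d j
    using nn_integral_affine_std_normal_square[OF normal[of "Suc j"], of "- c" d] by simp
  then show ?thesis
    unfolding pinsker_risk_def sq_norm_def error by (subst nn_integral_suminf) simp_all
qed

lemma one_minus_pinsker_coeff:
  "1 - pinsker_coeff \<beta> \<mu> j = min (\<mu> * pinsker_weight \<beta> j) 1"
  by (auto simp: pinsker_coeff_def min_def max_def)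

lemma pinsker_weight_nonneg [simp]: "0 \<le> pinsker_weight \<beta> j"
  by (simp add: pinsker_weight_def)

section \<open>The bandwidth parametrization\<close>

text \<open>
  The bandwidth \<open>h\<close> is, up to a constant, the number of coordinates that an optimal filter keeps at
  this noise level. The exponent makes \<open>\<epsilon>\<^sup>2 h\<close>, the variance of \<open>h\<close> coordinates, equal to \<open>h\<^bsup>-2\<beta>\<^esup>\<close>, the
  order of the squared bias of an element of the Sobolev space.
\<close>

definition noise_level :: "real \<Rightarrow> real \<Rightarrow> real" where
  "noise_level \<beta> h = h powr (- ((1 + 2 * \<beta>) / 2))"

lemma noise_level_pos: "h > 0 \<Longrightarrow> noise_level \<beta> h > 0"
  by (simp add: noise_level_def)

lemma noise_level_surj:
  assumes "\<beta> > 0" "\<epsilon> > 0"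
  obtains h where "h > 0" "\<epsilon> = noise_level \<beta> h"
proof
  show "\<epsilon> powr (- (2 / (1 + 2 * \<beta>))) > 0"
    using assms by simp
  show "\<epsilon> = noise_level \<beta> (\<epsilon> powr (- (2 / (1 + 2 * \<beta>))))"
    using assms by (simp add: noise_level_def powr_powr)
qed

lemma noise_level_square:
  assumes "h > 0"
  shows "(h powr \<beta>)\<^sup>2 * (noise_level \<beta> h)\<^sup>2 = 1 / h"
  using assms
  by (simp add: noise_level_def power2_eq_square flip: powr_add powr_minus_divide)

lemma normalizing_factor_noise_level:
  assumes "\<beta> > 0" "h > 0"
  shows "noise_level \<beta> h powr (- (4 * \<beta> / (1 + 2 * \<beta>))) = (h powr \<beta>)\<^sup>2"
proof -
  have "noise_level \<beta> h powr (- (4 * \<beta> / (1 + 2 * \<beta>))) = h powr (2 * \<beta>)"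
    using assms by (simp add: noise_level_def powr_powr)
  then show ?thesis
    by (simp add: power2_eq_square flip: powr_add)
qed

section \<open>Sobolev smoothness bounds the risk\<close>

text \<open>
  With \<open>\<mu> = h\<^bsup>-\<beta>\<^esup>\<close>, the bias is bounded through \<open>min (\<mu> b\<^sub>j) 1 \<le> \<mu> b\<^sub>j\<close>, and the variance through
  \<open>\<lambda>\<^sub>j \<le> 1\<close> together with \<open>\<lambda>\<^sub>j = 0\<close> for \<open>j \<ge> h\<close>. The resulting bound does not depend on \<open>\<epsilon>\<close>.
\<close>

lemma normalized_risk_le:
  fixes \<sigma> x :: "nat \<Rightarrow> real"
  assumes "prob_space M"
    and normal: "\<And>j. j \<ge> 1 \<Longrightarrow> distributed M lborel (\<xi> j) std_normal_density"
    and "\<beta> > 0" and "\<epsilon> > 0"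
    and noise: "\<And>j. j \<ge> 1 \<Longrightarrow> \<bar>\<sigma> j\<bar> \<le> S"
    and sobolev: "x \<in> sobolev_space \<beta>"
  shows "normalized_pinsker_risk M \<xi> \<sigma> \<beta> \<epsilon> x
    \<le> ennreal ((\<Sum>j. (pinsker_weight \<beta> (Suc j))\<^sup>2 * (x (Suc j))\<^sup>2) + S\<^sup>2)"
proof -
  obtain h where h: "h > 0" "\<epsilon> = noise_level \<beta> h"
    using noise_level_surj assms by blast
  define \<mu> where "\<mu> = h powr (- \<beta>)"
  \<comment> \<open>The coefficients of the coordinates \<open>Suc j\<close> with \<open>j \<ge> N\<close> vanish, since then \<open>Suc j > h\<close>.\<close>
  define N where "N = nat \<lfloor>h\<rfloor>"
  define e where "e = (\<lambda>j. (pinsker_weight \<beta> (Suc j))\<^sup>2 * (x (Suc j))\<^sup>2)"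
  define v where "v = (\<lambda>j::nat. if j < N then \<epsilon>\<^sup>2 * S\<^sup>2 else 0)"
  have "\<mu> > 0" and \<mu>h: "\<mu> * h powr \<beta> = 1"
    using h by (simp_all add: \<mu>_def flip: powr_add)
  have "S \<ge> 0"
    using noise[of 1] by simp
  have bias: "((1 - pinsker_coeff \<beta> \<mu> (Suc j)) * x (Suc j))\<^sup>2 \<le> \<mu>\<^sup>2 * e j" for j
  proof -
    have "(min (\<mu> * pinsker_weight \<beta> (Suc j)) 1)\<^sup>2 \<le> (\<mu> * pinsker_weight \<beta> (Suc j))\<^sup>2"
      using \<open>\<mu> > 0\<close> by (intro power_mono) auto
    then show ?thesis
      by (simp add: one_minus_pinsker_coeff e_def power_mult_distrib mult_right_mono
          flip: mult.assoc)
  qed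
  have variance: "(pinsker_coeff \<beta> \<mu> (Suc j) * \<epsilon> * \<sigma> (Suc j))\<^sup>2 \<le> v j" for j
  proof (cases "j < N")
    case True
    have "(pinsker_coeff \<beta> \<mu> (Suc j))\<^sup>2 \<le> 1"
      using \<open>\<mu> > 0\<close> by (intro power_le_one) (auto simp: pinsker_coeff_def)
    moreover have "(\<sigma> (Suc j))\<^sup>2 \<le> S\<^sup>2"
      using power_mono[OF noise[of "Suc j"] abs_ge_zero, of 2] by simp
    ultimately have "(pinsker_coeff \<beta> \<mu> (Suc j))\<^sup>2 * (\<sigma> (Suc j))\<^sup>2 \<le> 1 * S\<^sup>2"
      by (intro mult_mono) auto
    then have "\<epsilon>\<^sup>2 * ((pinsker_coeff \<beta> \<mu> (Suc j))\<^sup>2 * (\<sigma> (Suc j))\<^sup>2) \<le> \<epsilon>\<^sup>2 * (1 * S\<^sup>2)"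
      by (rule mult_left_mono) simp
    then show ?thesis
      using True by (simp add: v_def power_mult_distrib mult_ac)
  next
    case False
    then have "h \<le> real (Suc j)"
      using h unfolding N_def by linarith
    then have "h powr \<beta> \<le> real (Suc j) powr \<beta>"
      using h \<open>\<beta> > 0\<close> by (intro powr_mono2) auto
    then have "1 \<le> \<mu> * pinsker_weight \<beta> (Suc j)"
      using \<mu>h \<open>\<mu> > 0\<close> unfolding pinsker_weight_def by (metis mult_le_cancel_left_pos)
    then show ?thesis
      using False by (simp add: pinsker_coeff_def v_def)
  qed
  have "summable e"
    using sobolev by (simp add: sobolev_space_def e_def)
  have e_nonneg: "0 \<le> e j" and v_nonneg: "0 \<le> v j" for j
    by (simp_all add: e_def v_def)
  have v_sums: "v sums (real N * (\<epsilon>\<^sup>2 * S\<^sup>2))"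
    using sums_If_finite[of "\<lambda>j. j < N" "\<lambda>_. \<epsilon>\<^sup>2 * S\<^sup>2"] by (simp add: v_def)
  have "pinsker_risk M \<xi> \<sigma> \<beta> \<epsilon> \<mu> x \<le> (\<Sum>j. ennreal (\<mu>\<^sup>2 * e j + v j))"
    by (subst pinsker_risk_eq[OF \<open>prob_space M\<close> normal])
      (auto intro!: suminf_le ennreal_leI add_mono bias variance simp del: ennreal_plus)
  also have "\<dots> = ennreal (\<Sum>j. \<mu>\<^sup>2 * e j + v j)"
    using \<open>summable e\<close> v_sums e_nonneg v_nonneg
    by (intro suminf_ennreal2) (auto intro!: summable_add summable_mult simp: sums_iff)
  also have "(\<Sum>j. \<mu>\<^sup>2 * e j + v j) = \<mu>\<^sup>2 * suminf e + real N * (\<epsilon>\<^sup>2 * S\<^sup>2)"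
    using sums_add[OF sums_mult[OF summable_sums[OF \<open>summable e\<close>], of "\<mu>\<^sup>2"] v_sums]
    by (simp add: sums_iff)
  finally have risk: "pinsker_risk M \<xi> \<sigma> \<beta> \<epsilon> \<mu> x
      \<le> ennreal (\<mu>\<^sup>2 * suminf e + real N * (\<epsilon>\<^sup>2 * S\<^sup>2))" .
  have "normalized_pinsker_risk M \<xi> \<sigma> \<beta> \<epsilon> x
      \<le> ennreal ((h powr \<beta>)\<^sup>2) * pinsker_risk M \<xi> \<sigma> \<beta> \<epsilon> \<mu> x"
    unfolding normalized_pinsker_risk_def h(2) normalizing_factor_noise_level[OF \<open>\<beta> > 0\<close> h(1)]
    using \<open>\<mu> > 0\<close> by (intro mult_left_mono INF_lower) auto
  also have "\<dots> \<le> ennreal ((h powr \<beta>)\<^sup>2) * ennreal (\<mu>\<^sup>2 * suminf e + real N * (\<epsilon>\<^sup>2 * S\<^sup>2))"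
    by (intro mult_left_mono risk) simp
  also have "\<dots> = ennreal ((h powr \<beta>)\<^sup>2 * (\<mu>\<^sup>2 * suminf e + real N * (\<epsilon>\<^sup>2 * S\<^sup>2)))"
    by (simp add: ennreal_mult')
  also have "(h powr \<beta>)\<^sup>2 * (\<mu>\<^sup>2 * suminf e + real N * (\<epsilon>\<^sup>2 * S\<^sup>2))
      = (\<mu> * h powr \<beta>)\<^sup>2 * suminf e + real N * ((h powr \<beta>)\<^sup>2 * \<epsilon>\<^sup>2) * S\<^sup>2"
    by (simp add: power_mult_distrib algebra_simps)
  also have "\<dots> = suminf e + real N / h * S\<^sup>2"
    by (simp add: \<mu>h h(2) noise_level_square[OF h(1)])
  also have "ennreal \<dots> \<le> ennreal (suminf e + S\<^sup>2)"
  proof -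
    have "real N / h \<le> 1"
      using h unfolding N_def by (simp add: divide_le_eq_1)
    then have "real N / h * S\<^sup>2 \<le> S\<^sup>2"
      using mult_right_mono[of "real N / h" 1 "S\<^sup>2"] by simp
    then show ?thesis
      by (intro ennreal_leI add_left_mono)
  qed
  finally show ?thesis
    unfolding e_def .
qed

section \<open>Bounded risk forces Sobolev smoothness\<close>

lemma near_optimal_parameter:
  assumes "\<beta> > 0" and "h > 0"
    and "normalized_pinsker_risk M \<xi> \<sigma> \<beta> (noise_level \<beta> h) x < ennreal C"
  obtains \<mu> where "\<mu> > 0"
    and "pinsker_risk M \<xi> \<sigma> \<beta> (noise_level \<beta> h) \<mu> x < ennreal (C / (h powr \<beta>)\<^sup>2)"
proof -
  let ?I = "INF \<mu>\<in>{0<..}. pinsker_risk M \<xi> \<sigma> \<beta> (noise_level \<beta> h) \<mu> x"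
  have less: "ennreal ((h powr \<beta>)\<^sup>2) * ?I < ennreal C"
    using assms normalizing_factor_noise_level[of \<beta> h] by (simp add: normalized_pinsker_risk_def)
  have "?I < ennreal (C / (h powr \<beta>)\<^sup>2)"
  proof (rule ccontr)
    assume "\<not> ?thesis"
    then have "ennreal ((h powr \<beta>)\<^sup>2) * ennreal (C / (h powr \<beta>)\<^sup>2) \<le> ennreal ((h powr \<beta>)\<^sup>2) * ?I"
      by (intro mult_left_mono) (auto simp: not_less)
    moreover have "ennreal ((h powr \<beta>)\<^sup>2) * ennreal (C / (h powr \<beta>)\<^sup>2) = ennreal C"
      using \<open>h > 0\<close> by (simp flip: ennreal_mult')
    ultimately show False
      using less by simp
  qed
  then show ?thesis
    using that by (auto simp: INF_less_iff)
qed

lemma sum_bias_variance_less: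
  assumes "prob_space M"
    and normal: "\<And>j. j \<ge> 1 \<Longrightarrow> distributed M lborel (\<xi> j) std_normal_density"
    and "pinsker_risk M \<xi> \<sigma> \<beta> \<epsilon> \<mu> x < ennreal D"
  shows "(\<Sum>j<n. ((1 - pinsker_coeff \<beta> \<mu> (Suc j)) * x (Suc j))\<^sup>2
                + (pinsker_coeff \<beta> \<mu> (Suc j) * \<epsilon> * \<sigma> (Suc j))\<^sup>2) < D"
    (is "sum ?r _ < D")
proof -
  have "ennreal (sum ?r {..<n}) = (\<Sum>j<n. ennreal (?r j))"
    by (intro sum_ennreal[symmetric]) auto
  also have "\<dots> \<le> (\<Sum>j. ennreal (?r j))"
    by (intro sum_le_suminf) auto
  also have "\<dots> < ennreal D"
    using assms pinsker_risk_eq[OF \<open>prob_space M\<close> normal] by simp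
  finally show ?thesis
    by (simp add: ennreal_less_iff sum_nonneg)
qed

text \<open>
  If \<open>\<mu> (k N)\<^sup>\<beta> < 1/2\<close>, the first \<open>k N\<close> coefficients are all at least \<open>1/2\<close>, and their variance,
  normalized, is at least \<open>s\<^sup>2 k / 4 \<ge> C\<close>, which contradicts the bound on the risk.
\<close>

lemma parameter_lower_bound:
  fixes \<sigma> x :: "nat \<Rightarrow> real" and k N :: nat
  assumes "prob_space M"
    and normal: "\<And>j. j \<ge> 1 \<Longrightarrow> distributed M lborel (\<xi> j) std_normal_density"
    and "\<beta> > 0" and "s > 0" and noise: "\<And>j. j \<ge> 1 \<Longrightarrow> s \<le> \<sigma> j"
    and "N > 0" and k: "4 * C \<le> real k * s\<^sup>2" and "\<mu> > 0"
    and risk: "pinsker_risk M \<xi> \<sigma> \<beta> (noise_level \<beta> (real N)) \<mu> x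
      < ennreal (C / (real N powr \<beta>)\<^sup>2)"
  shows "1 / 2 \<le> \<mu> * real (k * N) powr \<beta>"
proof (rule ccontr)
  assume "\<not> ?thesis"
  then have small: "\<mu> * real (k * N) powr \<beta> < 1 / 2"
    by simp
  let ?\<epsilon> = "noise_level \<beta> (real N)"
  have term_ge: "(1 / 2 * ?\<epsilon> * s)\<^sup>2 \<le> ((1 - pinsker_coeff \<beta> \<mu> (Suc j)) * x (Suc j))\<^sup>2
                + (pinsker_coeff \<beta> \<mu> (Suc j) * ?\<epsilon> * \<sigma> (Suc j))\<^sup>2" if "j < k * N" for j
  proof -
    have "real (Suc j) powr \<beta> \<le> real (k * N) powr \<beta>"
      using that \<open>\<beta> > 0\<close> by (intro powr_mono2) (auto simp del: of_nat_Suc of_nat_mult)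
    then have "\<mu> * real (Suc j) powr \<beta> \<le> \<mu> * real (k * N) powr \<beta>"
      using \<open>\<mu> > 0\<close> by (intro mult_left_mono) auto
    then have "1 / 2 \<le> pinsker_coeff \<beta> \<mu> (Suc j)"
      using small unfolding pinsker_coeff_def pinsker_weight_def by linarith
    then have "1 / 2 * ?\<epsilon> * s \<le> pinsker_coeff \<beta> \<mu> (Suc j) * ?\<epsilon> * \<sigma> (Suc j)"
      using noise[of "Suc j"] \<open>s > 0\<close> \<open>N > 0\<close> noise_level_pos[of "real N" \<beta>]
      by (intro mult_mono) auto
    then have "(1 / 2 * ?\<epsilon> * s)\<^sup>2 \<le> (pinsker_coeff \<beta> \<mu> (Suc j) * ?\<epsilon> * \<sigma> (Suc j))\<^sup>2"
      using \<open>s > 0\<close> \<open>N > 0\<close> noise_level_pos[of "real N" \<beta>] by (intro power_mono) auto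
    then show ?thesis
      by (simp add: add_increasing)
  qed
  have "real (k * N) * (1 / 2 * ?\<epsilon> * s)\<^sup>2 = (\<Sum>j<k * N. (1 / 2 * ?\<epsilon> * s)\<^sup>2)"
    by simp
  also have "\<dots> \<le> (\<Sum>j<k * N. ((1 - pinsker_coeff \<beta> \<mu> (Suc j)) * x (Suc j))\<^sup>2
                + (pinsker_coeff \<beta> \<mu> (Suc j) * ?\<epsilon> * \<sigma> (Suc j))\<^sup>2)"
    using term_ge by (intro sum_mono) auto
  also have "\<dots> < C / (real N powr \<beta>)\<^sup>2"
    by (rule sum_bias_variance_less[OF \<open>prob_space M\<close> normal risk])
  finally have "real (k * N) * ((real N powr \<beta>)\<^sup>2 * ?\<epsilon>\<^sup>2) * s\<^sup>2 / 4 < C"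
    using \<open>N > 0\<close> by (simp add: field_simps power_mult_distrib)
  then show False
    using k \<open>N > 0\<close> by (simp add: noise_level_square)
qed

text \<open>
  The lower bound on \<open>\<mu>\<close> gives \<open>min (\<mu> b\<^sub>j) 1 \<ge> b\<^sub>j / a\<close> for \<open>j \<le> N\<close>, where \<open>a = 2 (k N)\<^sup>\<beta>\<close>: the truncation
  at \<open>1\<close> does no harm, because \<open>b\<^sub>j \<le> a\<close> for these \<open>j\<close>. Hence the bias controls the weighted energy of
  the first \<open>N\<close> coordinates. The factor \<open>N\<^sup>\<beta>\<close> in \<open>a\<close> is cancelled by the normalization, so that the final
  bound does not depend on \<open>N\<close>.
\<close>

lemma weighted_energy_le:
  fixes \<sigma> x :: "nat \<Rightarrow> real" and k N :: nat
  assumes "prob_space M"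
    and normal: "\<And>j. j \<ge> 1 \<Longrightarrow> distributed M lborel (\<xi> j) std_normal_density"
    and "\<beta> > 0" and "s > 0" and noise: "\<And>j. j \<ge> 1 \<Longrightarrow> s \<le> \<sigma> j"
    and "N > 0" and "k > 0" and k: "4 * C \<le> real k * s\<^sup>2"
    and bounded: "normalized_pinsker_risk M \<xi> \<sigma> \<beta> (noise_level \<beta> (real N)) x < ennreal C"
  shows "(\<Sum>j<N. (pinsker_weight \<beta> (Suc j))\<^sup>2 * (x (Suc j))\<^sup>2) \<le> (2 * real k powr \<beta>)\<^sup>2 * C"
proof -
  let ?\<epsilon> = "noise_level \<beta> (real N)"
  define a where "a = 2 * real k powr \<beta> * real N powr \<beta>"
  have "a > 0"
    using \<open>k > 0\<close> \<open>N > 0\<close> by (simp add: a_def)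
  obtain \<mu> where "\<mu> > 0"
    and risk: "pinsker_risk M \<xi> \<sigma> \<beta> ?\<epsilon> \<mu> x < ennreal (C / (real N powr \<beta>)\<^sup>2)"
    using near_optimal_parameter[OF \<open>\<beta> > 0\<close> _ bounded] \<open>N > 0\<close> by auto
  have "1 / 2 \<le> \<mu> * real (k * N) powr \<beta>"
    by (rule parameter_lower_bound[OF \<open>prob_space M\<close> normal \<open>\<beta> > 0\<close> \<open>s > 0\<close> noise \<open>N > 0\<close> k
          \<open>\<mu> > 0\<close> risk])
  then have \<mu>: "1 / a \<le> \<mu>"
    using \<open>a > 0\<close> by (simp add: a_def field_simps powr_mult)
  have "pinsker_weight \<beta> (Suc j) / a \<le> 1 - pinsker_coeff \<beta> \<mu> (Suc j)" if "j < N" for j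
  proof -
    have "real (Suc j) powr \<beta> \<le> real N powr \<beta>"
      using that \<open>\<beta> > 0\<close> by (intro powr_mono2) auto
    also have "\<dots> \<le> a"
    proof -
      have "1 \<le> real k powr \<beta>"
        using \<open>k > 0\<close> \<open>\<beta> > 0\<close> by (intro ge_one_powr_ge_zero) auto
      then have "1 \<le> 2 * real k powr \<beta>"
        by simp
      then show ?thesis
        unfolding a_def using mult_right_mono[of 1 _ "real N powr \<beta>"] by simp
    qed
    finally have "pinsker_weight \<beta> (Suc j) / a \<le> 1"
      using \<open>a > 0\<close> by (simp add: pinsker_weight_def)
    moreover have "pinsker_weight \<beta> (Suc j) / a \<le> \<mu> * pinsker_weight \<beta> (Suc j)"
      using mult_right_mono[OF \<mu>, of "pinsker_weight \<beta> (Suc j)"] by simp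
    ultimately show ?thesis
      by (simp add: one_minus_pinsker_coeff)
  qed
  then have "(pinsker_weight \<beta> (Suc j) / a)\<^sup>2 * (x (Suc j))\<^sup>2
      \<le> (1 - pinsker_coeff \<beta> \<mu> (Suc j))\<^sup>2 * (x (Suc j))\<^sup>2" if "j < N" for j
    using that \<open>a > 0\<close> by (intro mult_right_mono power_mono) auto
  then have "(\<Sum>j<N. (pinsker_weight \<beta> (Suc j) / a)\<^sup>2 * (x (Suc j))\<^sup>2)
      \<le> (\<Sum>j<N. ((1 - pinsker_coeff \<beta> \<mu> (Suc j)) * x (Suc j))\<^sup>2
                + (pinsker_coeff \<beta> \<mu> (Suc j) * ?\<epsilon> * \<sigma> (Suc j))\<^sup>2)"
    by (intro sum_mono) (auto simp: power_mult_distrib add_increasing2)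
  also have "\<dots> < C / (real N powr \<beta>)\<^sup>2"
    by (rule sum_bias_variance_less[OF \<open>prob_space M\<close> normal risk])
  finally have "(\<Sum>j<N. (pinsker_weight \<beta> (Suc j))\<^sup>2 * (x (Suc j))\<^sup>2) / a\<^sup>2 < C / (real N powr \<beta>)\<^sup>2"
    by (simp add: power_divide sum_divide_distrib)
  then have "(\<Sum>j<N. (pinsker_weight \<beta> (Suc j))\<^sup>2 * (x (Suc j))\<^sup>2) < a\<^sup>2 * (C / (real N powr \<beta>)\<^sup>2)"
    using \<open>a > 0\<close> by (simp add: pos_divide_less_eq mult.commute)
  also have "\<dots> = (2 * real k powr \<beta>)\<^sup>2 * C"
    using \<open>N > 0\<close> by (simp add: a_def power_mult_distrib)
  finally show ?thesis
    by simp
qed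

section \<open>The characterization\<close>

theorem theorem2p4:
  fixes M :: "'a measure" and \<xi> :: "nat \<Rightarrow> 'a \<Rightarrow> real"
    and \<sigma> x :: "nat \<Rightarrow> real" and \<beta> s S :: real
  assumes "prob_space M"
    and "prob_space.indep_vars M (\<lambda>_. borel) \<xi> {1..}"
    and "\<And>j. j \<ge> 1 \<Longrightarrow> distributed M lborel (\<xi> j) std_normal_density"
    and "\<beta> > 0"
    and "s > 0"
    and "\<And>j. j \<ge> 1 \<Longrightarrow> s \<le> \<sigma> j \<and> \<sigma> j \<le> S"
  shows "(\<exists>C::real. C > 0 \<and> (\<forall>\<epsilon>>0. normalized_pinsker_risk M \<xi> \<sigma> \<beta> \<epsilon> x < ennreal C))
     \<longleftrightarrow> x \<in> sobolev_space \<beta>"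
proof
  assume "\<exists>C::real. C > 0 \<and> (\<forall>\<epsilon>>0. normalized_pinsker_risk M \<xi> \<sigma> \<beta> \<epsilon> x < ennreal C)"
  then obtain C where "C > 0"
    and bounded: "\<And>\<epsilon>. \<epsilon> > 0 \<Longrightarrow> normalized_pinsker_risk M \<xi> \<sigma> \<beta> \<epsilon> x < ennreal C"
    by blast
  obtain k :: nat where "4 * C / s\<^sup>2 \<le> real k"
    using real_arch_simple by blast
  then have k: "4 * C \<le> real k * s\<^sup>2"
    using \<open>s > 0\<close> by (simp add: divide_le_eq)
  have "k > 0"
    using k \<open>C > 0\<close> by (cases k) auto
  have "(\<Sum>j<n. (pinsker_weight \<beta> (Suc j))\<^sup>2 * (x (Suc j))\<^sup>2) \<le> (2 * real k powr \<beta>)\<^sup>2 * C" for n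
  proof (cases "n = 0")
    case False
    then show ?thesis
      using assms \<open>k > 0\<close> k bounded noise_level_pos
      by (intro weighted_energy_le[where M = M and \<xi> = \<xi> and \<sigma> = \<sigma> and s = s]) auto
  qed (use \<open>C > 0\<close> in simp)
  then have "summable (\<lambda>j. (pinsker_weight \<beta> (Suc j))\<^sup>2 * (x (Suc j))\<^sup>2)"
    by (intro summableI_nonneg_bounded) auto
  then show "x \<in> sobolev_space \<beta>"
    by (simp add: sobolev_space_def)
next
  assume sobolev: "x \<in> sobolev_space \<beta>"
  define B where "B = (\<Sum>j. (pinsker_weight \<beta> (Suc j))\<^sup>2 * (x (Suc j))\<^sup>2) + S\<^sup>2"
  have "B \<ge> 0"
    unfolding B_def using sobolev by (intro add_nonneg_nonneg suminf_nonneg)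
      (auto simp: sobolev_space_def)
  have "\<bar>\<sigma> j\<bar> \<le> S" if "j \<ge> 1" for j
    using assms(6)[OF that] \<open>s > 0\<close> by linarith
  then have "normalized_pinsker_risk M \<xi> \<sigma> \<beta> \<epsilon> x \<le> ennreal B" if "\<epsilon> > 0" for \<epsilon>
    unfolding B_def using assms(1,3,4) that sobolev by (intro normalized_risk_le) auto
  moreover have "ennreal B < ennreal (B + 1)"
    using \<open>B \<ge> 0\<close> by (simp add: ennreal_less_iff)
  ultimately show "\<exists>C::real. C > 0 \<and> (\<forall>\<epsilon>>0. normalized_pinsker_risk M \<xi> \<sigma> \<beta> \<epsilon> x < ennreal C)"
    using \<open>B \<ge> 0\<close>
    by (intro exI[of _ "B + 1"]) (auto intro: le_less_trans simp del: ennreal_plus)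
qed

end
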